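(* Let $X$ be a set and let $L,M:X\times X\to\mathbb{C}$ be symmetric bi-functions. Then $L$ and $M$ are reciprocal rescalings of each other if and only if $\det_{L}(x_{1},\dots,x_{n})=\det_{M}(x_{1},\dots,x_{n})$ for all $n\in\mathbb{N}$ and all $x_{1},\dots,x_{n}\in X$.
   Context: A bi-function on a set $X$ is a function $X\times X\to\mathbb{C}$; it is symmetric if $L(x,y)=L(y,x)$ for all $x,y\in X$. For a bi-function $L$ on $X$ and $x_{1},\dots,x_{n}\in X$ put $\det_{L}(x_{1},\dots,x_{n})=\det[L(x_{i},x_{j})]_{i,j=1}^{n}$. Bi-functions $L$ and $M$ are reciprocal rescalings if there is a non-vanishing function $f:X\to\mathbb{C}\setminus\{0\}$ such that $M(x,y)=f(x)\frac{1}{f(y)}L(x,y)$ for all $x,y\in X$. *)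

theory Defs
  imports Complex_Main "Jordan_Normal_Form.Determinant"
begin

(* A bi-function on X is a curried function on the ambient type; only its values on
   X \<times> X are ever constrained or used. *)

definition symmetric_on :: "'a set \<Rightarrow> ('a \<Rightarrow> 'a \<Rightarrow> complex) \<Rightarrow> bool" where
  "symmetric_on X L \<longleftrightarrow> (\<forall>x\<in>X. \<forall>y\<in>X. L x y = L y x)"

(* The points x_1, ..., x_n are x 0, ..., x (n - 1), repetitions allowed;
   for n = 0 the determinant is 1. *)
definition bifun_det :: "('a \<Rightarrow> 'a \<Rightarrow> complex) \<Rightarrow> nat \<Rightarrow> (nat \<Rightarrow> 'a) \<Rightarrow> complex" where
  "bifun_det L n x = det (mat n n (\<lambda>(i, j). L (x i) (x j)))"

definition reciprocal_rescalings ::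
  "'a set \<Rightarrow> ('a \<Rightarrow> 'a \<Rightarrow> complex) \<Rightarrow> ('a \<Rightarrow> 'a \<Rightarrow> complex) \<Rightarrow> bool" where
  "reciprocal_rescalings X L M \<longleftrightarrow>
    (\<exists>f :: 'a \<Rightarrow> complex. (\<forall>x\<in>X. f x \<noteq> 0) \<and>
      (\<forall>x\<in>X. \<forall>y\<in>X. M x y = f x * (1 / f y) * L x y))"

end

theory Submission
  imports Defs
begin

text \<open>
  For the nontrivial direction, the minors of size at most two give M = L or M = -L at every pair.
  Call x and y adjacent if L x y is nonzero. The quotient M / L is a sign on every edge, and one has
  to find f with values in {1, -1} such that M x y = f x * f y * L x y. This is a walk-lifting
  problem in the double cover of the graph, and f exists unless some closed walk has sign -1. A
  shortest such walk has no chords, because a chord would split it into two shorter closed walks,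
  one of which again has sign -1. In the determinant along a chordless cycle, every permutation
  contributes equally for L and M except the two rotations, whose contributions are nonzero, equal
  to each other, and change sign. So the determinants of L and M along this cycle differ.
\<close>

section \<open>Determinants as sums over permutations\<close>

lemma bifun_det_sum:
  "bifun_det L n x =
    (\<Sum>p | p permutes {0..<n}. signof p * (\<Prod>i = 0..<n. L (x i) (x (p i))))"
proof -
  have "(\<Prod>i = 0..<n. mat n n (\<lambda>(i, j). L (x i) (x j)) $$ (i, p i)) =
      (\<Prod>i = 0..<n. L (x i) (x (p i)))" if "p permutes {0..<n}" for p
    using permutes_in_image[OF that] by (intro prod.cong) auto
  then show ?thesis
    unfolding bifun_det_def by (subst det_def') (auto intro!: sum.cong)
qed

lemma bifun_det_2:
  "bifun_det L 2 x = L (x 0) (x 0) * L (x 1) (x 1) - L (x 0) (x 1) * L (x 1) (x 0)"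
proof -
  let ?A = "mat 2 2 (\<lambda>(i, j). L (x i) (x j))"
  have "det ?A = (\<Sum>i<2. ?A $$ (i, 0) * cofactor ?A i 0)"
    by (rule laplace_expansion_column) auto
  moreover have "cofactor ?A 0 0 = L (x 1) (x 1)" "cofactor ?A 1 0 = - L (x 0) (x 1)"
    unfolding cofactor_def by (subst det_single; simp add: mat_delete_def)+
  ultimately show ?thesis
    by (simp add: bifun_det_def numeral_2_eq_2)
qed

text \<open>The denominators \<open>g (p i)\<close> are the numerators \<open>g i\<close> in another
  order, so they cancel in the product. This serves both the easy direction and the cycle
  computation.\<close>

lemma prod_rescale_permutes:
  fixes g :: "'i \<Rightarrow> 'b::field"
  assumes "p permutes S" and "finite S" and "\<And>i. i \<in> S \<Longrightarrow> g i \<noteq> 0"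
  shows "(\<Prod>i\<in>S. g i * (1 / g (p i)) * h i) = (\<Prod>i\<in>S. h i)"
proof -
  have "(\<Prod>i\<in>S. g (p i)) = (\<Prod>i\<in>S. g i)"
    using prod.permute[OF assms(1), of g] by (simp add: o_def)
  moreover have "(\<Prod>i\<in>S. g i) \<noteq> 0"
    using assms by simp
  ultimately show ?thesis
    by (simp add: prod.distrib prod_dividef)
qed

lemma bifun_det_eq_if_reciprocal_rescalings:
  assumes "reciprocal_rescalings X L M" and "\<And>i. i < n \<Longrightarrow> x i \<in> X"
  shows "bifun_det L n x = bifun_det M n x"
proof -
  obtain f where f: "\<And>x. x \<in> X \<Longrightarrow> f x \<noteq> 0"
      "\<And>x y. \<lbrakk>x \<in> X; y \<in> X\<rbrakk> \<Longrightarrow> M x y = f x * (1 / f y) * L x y"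
    using assms(1) unfolding reciprocal_rescalings_def by blast
  have "(\<Prod>i = 0..<n. M (x i) (x (p i))) = (\<Prod>i = 0..<n. L (x i) (x (p i)))"
    if p: "p permutes {0..<n}" for p
  proof -
    have "(\<Prod>i = 0..<n. M (x i) (x (p i))) =
        (\<Prod>i = 0..<n. f (x i) * (1 / f (x (p i))) * L (x i) (x (p i)))"
      using permutes_in_image[OF p] assms(2) by (intro prod.cong refl f(2)) auto
    also have "\<dots> = (\<Prod>i = 0..<n. L (x i) (x (p i)))"
      using prod_rescale_permutes[OF p, of "f \<circ> x"] assms(2) f(1) by simp
    finally show ?thesis .
  qed
  then show ?thesis
    by (simp add: bifun_det_sum)
qed

section \<open>Permutations along a chordless cycle\<close>

text \<open>This is the backward rotation of the cycle; the forward one enters as its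
  inverse.\<close>

definition rotation :: "nat \<Rightarrow> nat \<Rightarrow> nat" where
  "rotation n i = (if i < n then if i = 0 then n - 1 else i - 1 else i)"

lemma rotation_permutes: "rotation n permutes {0..<n}"
proof (rule bij_imp_permutes)
  have "inj_on (rotation n) {0..<n}"
    by (auto simp: inj_on_def rotation_def split: if_splits)
  moreover have "rotation n ` {0..<n} \<subseteq> {0..<n}"
    by (auto simp: rotation_def)
  ultimately show "bij_betw (rotation n) {0..<n} {0..<n}"
    by (simp add: bij_betw_def endo_inj_surj)
qed (auto simp: rotation_def)

text \<open>The preimages of 0, 1, 2, ... are forced in turn. The preimage of \<open>k\<close> is
  among \<open>k - 1\<close>, \<open>k\<close> and \<open>k + 1\<close>; the first two already have
  other images, so it is \<open>k + 1\<close>. At \<open>k = 0\<close> the assumption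
  \<open>p (n - 1) \<noteq> 0\<close> rules out the wrap-around.\<close>

lemma permutes_eq_rotation:
  assumes p: "p permutes {0..<n}" and n: "n \<ge> 3"
    and near: "\<And>i. i < n \<Longrightarrow> i = p i \<or> i = Suc (p i) \<or> p i = Suc i \<or>
      (i = 0 \<and> p i = n - 1) \<or> (i = n - 1 \<and> p i = 0)"
    and ends: "p 0 = n - 1" "p (n - 1) \<noteq> 0"
  shows "p = rotation n"
proof -
  have step: "p (Suc k) = k" if "Suc k < n" for k
    using that
  proof (induction k rule: less_induct)
    case (less k)
    obtain q where q: "p q = k" "q < n"
      using less.prems permutes_in_image[OF p, of "inv_into UNIV p k"] permutes_inverses(1)[OF p]
      by (metis Suc_lessD atLeastLessThan_iff zero_le)
    have "q = k \<or> q = Suc k \<or> k = Suc q"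
      using near[of q] q ends less.prems by auto
    moreover have "q \<noteq> k"
      using q less ends n by (cases k; cases "q = 0") auto
    moreover have "k \<noteq> Suc q"
      using q less ends n by (cases q) auto
    ultimately show ?case
      using q by auto
  qed
  show ?thesis
  proof
    fix i
    show "p i = rotation n i"
      using step[of "i - 1"] ends(1) permutes_not_in[OF p, of i]
      by (cases "i < n"; cases i) (auto simp: rotation_def)
  qed
qed

text \<open>The hypothesis on \<open>B\<close> collects all signs on the edge between 0 and
  \<open>n - 1\<close>, up to a rescaling by \<open>g\<close> that cancels in each summand. A
  summand is therefore negated exactly when its permutation uses that edge in just one
  direction.\<close>

lemma bifun_det_chordless_cycle_neq:
  fixes L M :: "'a \<Rightarrow> 'a \<Rightarrow> complex" and v :: "nat \<Rightarrow> 'a" and g :: "nat \<Rightarrow> complex"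
  defines "A \<equiv> \<lambda>i j. L (v i) (v j)" and "B \<equiv> \<lambda>i j. M (v i) (v j)"
  assumes n: "n \<ge> 3"
    and sym: "\<And>i j. \<lbrakk>i < n; j < n\<rbrakk> \<Longrightarrow> A i j = A j i"
    and chordless: "\<And>i j. \<lbrakk>Suc i < j; j < n; i \<noteq> 0 \<or> j \<noteq> n - 1\<rbrakk> \<Longrightarrow> A i j = 0"
    and edge: "\<And>i. Suc i < n \<Longrightarrow> A i (Suc i) \<noteq> 0" "A 0 (n - 1) \<noteq> 0"
    and g: "\<And>i. i < n \<Longrightarrow> g i \<noteq> 0"
    and B: "\<And>i j. \<lbrakk>i < n; j < n\<rbrakk> \<Longrightarrow> B i j = g i * (1 / g j) *
      ((if i = 0 \<and> j = n - 1 \<or> i = n - 1 \<and> j = 0 then -1 else 1) * A i j)"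
  shows "bifun_det L n v \<noteq> bifun_det M n v"
proof
  assume eq: "bifun_det L n v = bifun_det M n v"
  define t where "t p = signof p * (\<Prod>i = 0..<n. A i (p i))" for p
  define u where "u p = signof p * (\<Prod>i = 0..<n. B i (p i))" for p
  define c where "c = rotation n"
  define P where "P = {p. p permutes {0..<n}}"
  have c: "c permutes {0..<n}"
    unfolding c_def by (rule rotation_permutes)
  have u: "u p = (if (p 0 = n - 1) = (p (n - 1) = 0) then t p else - t p)" if "p \<in> P" for p
  proof -
    have p: "p permutes {0..<n}"
      using that by (simp add: P_def)
    define s :: "nat \<Rightarrow> complex"
      where "s i = (if i = 0 \<and> p i = n - 1 \<or> i = n - 1 \<and> p i = 0 then -1 else 1)" for i
    define e where "e \<longleftrightarrow> (p 0 = n - 1) = (p (n - 1) = 0)"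
    have "(\<Prod>i = 0..<n. B i (p i)) = (\<Prod>i = 0..<n. g i * (1 / g (p i)) * (s i * A i (p i)))"
      using permutes_in_image[OF p] by (intro prod.cong refl) (auto simp: B s_def)
    also have "\<dots> = (\<Prod>i = 0..<n. s i) * (\<Prod>i = 0..<n. A i (p i))"
      using prod_rescale_permutes[OF p, of g "\<lambda>i. s i * A i (p i)"] g
      by (simp add: prod.distrib)
    \<comment> \<open>Only the two distinct indices 0 and \<open>n - 1\<close> can carry a sign -1,
      and the signs cancel if the edge is used both ways.\<close>
    also have "(\<Prod>i = 0..<n. s i) = (\<Prod>i\<in>{0, n - 1}. s i)"
      using n by (intro prod.mono_neutral_right) (auto simp: s_def)
    also have "\<dots> = (if e then 1 else -1)"
      using n by (auto simp: s_def e_def)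
    finally show ?thesis
      unfolding u_def t_def e_def[symmetric] by simp
  qed
  have near: "i = j \<or> i = Suc j \<or> j = Suc i \<or> (i = 0 \<and> j = n - 1) \<or> (i = n - 1 \<and> j = 0)"
    if "A i j \<noteq> 0" "i < n" "j < n" for i j
    using chordless[of i j] chordless[of j i] sym[of i j] that
    by (metis Suc_lessI linorder_neqE_nat)
  have t_zero: "A i (p i) \<noteq> 0" if "t p \<noteq> 0" "i < n" for p i
    using that by (auto simp: t_def)
  have t_inv: "t (inv_into UNIV p) = t p" if "p \<in> P" for p
  proof -
    have p: "p permutes {0..<n}"
      using that by (simp add: P_def)
    \<comment> \<open>Reindexing by \<open>p\<close> produces the factors \<open>A (p i) i\<close>,
      and symmetry turns them into \<open>A i (p i)\<close>.\<close>
    have "(\<Prod>i = 0..<n. A i (inv_into UNIV p i)) = (\<Prod>i = 0..<n. A (p i) (inv_into UNIV p (p i)))"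
      using prod.permute[OF p, of "\<lambda>i. A i (inv_into UNIV p i)"] by (simp add: o_def)
    also have "\<dots> = (\<Prod>i = 0..<n. A i (p i))"
      using permutes_in_image[OF p] permutes_inverses(2)[OF p]
      by (intro prod.cong refl) (auto simp: sym)
    finally have "(\<Prod>i = 0..<n. A i (inv_into UNIV p i)) = (\<Prod>i = 0..<n. A i (p i))" .
    moreover have "sign (inv_into UNIV p) = sign p"
      using p by (intro sign_inverse) (auto simp: permutation_permutes)
    ultimately show ?thesis
      by (simp add: t_def)
  qed
  have support: "p \<in> {c, inv_into UNIV c}" if p: "p \<in> P" and neq: "t p \<noteq> u p" for p
  proof -
    have perm: "p permutes {0..<n}"
      using p by (simp add: P_def)
    have iperm: "inv_into UNIV p permutes {0..<n}"
      using permutes_inv[OF perm] .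
    have t: "t p \<noteq> 0"
      using neq u[OF p] by (auto split: if_splits)
    have "(p 0 = n - 1) \<noteq> (p (n - 1) = 0)"
      using neq u[OF p] by metis
    then consider "p 0 = n - 1" "p (n - 1) \<noteq> 0" | "p 0 \<noteq> n - 1" "p (n - 1) = 0"
      by metis
    then show ?thesis
    proof cases
      case 1
      have "p = c"
        unfolding c_def using permutes_in_image[OF perm]
        by (intro permutes_eq_rotation[OF perm n _ 1] near t_zero t) auto
      then show ?thesis
        by simp
    next
      case 2
      \<comment> \<open>Inversion exchanges the two directions of the closing edge and so reduces to
        the previous case; \<open>t_inv\<close> carries over the nonvanishing.\<close>
      have *: "inv_into UNIV p 0 = n - 1" "inv_into UNIV p (n - 1) \<noteq> 0"
        using 2 permutes_inverses[OF perm] by metis+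
      have "inv_into UNIV p = c"
        unfolding c_def using permutes_in_image[OF iperm] t t_inv[OF p]
        by (intro permutes_eq_rotation[OF iperm n _ *] near t_zero) auto
      then show ?thesis
        using permutes_inv_inv[OF perm] by auto
    qed
  qed
  have cP: "c \<in> P" "inv_into UNIV c \<in> P"
    using c permutes_inv[OF c] by (auto simp: P_def)
  \<comment> \<open>As \<open>n \<ge> 3\<close>, each of the two rotations uses the closing edge in
    one direction only, and they are distinct.\<close>
  have "c 0 = n - 1" "c (n - 1) \<noteq> 0" "c 1 = 0"
    using n by (auto simp: c_def rotation_def)
  moreover from this have "inv_into UNIV c 0 \<noteq> n - 1" "inv_into UNIV c (n - 1) = 0"
    using permutes_inverses[OF c] by metis+
  ultimately have flip: "u c = - t c" "u (inv_into UNIV c) = - t (inv_into UNIV c)" "c \<noteq> inv_into UNIV c"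
    using u[OF cP(1)] u[OF cP(2)] by auto
  have "A i (c i) \<noteq> 0" if "i < n" for i
  proof (cases i)
    case 0
    then show ?thesis
      using edge(2) that by (simp add: c_def rotation_def)
  next
    case (Suc k)
    then show ?thesis
      using edge(1)[of k] sym[of i k] that by (simp add: c_def rotation_def)
  qed
  then have "t c \<noteq> 0"
    by (simp add: t_def sign_def)
  have finP: "finite P"
    by (simp add: P_def finite_permutations)
  have "0 = (\<Sum>p\<in>P. t p) - (\<Sum>p\<in>P. u p)"
    using eq unfolding bifun_det_sum t_def u_def A_def B_def P_def by simp
  also have "\<dots> = (\<Sum>p\<in>P. t p - u p)"
    by (simp add: sum_subtractf)
  also have "\<dots> = (\<Sum>p\<in>{c, inv_into UNIV c}. t p - u p)"
    using cP support finP by (intro sum.mono_neutral_right) auto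
  \<comment> \<open>Each rotation contributes \<open>2 * t p\<close>, and \<open>t\<close> agrees on
    the two.\<close>
  also have "\<dots> = 4 * t c"
    using flip t_inv[OF cP(1)] by simp
  finally show False
    using \<open>t c \<noteq> 0\<close> by simp
qed

text \<open>The edges of the double cover: the vertex x splits into (x, 1) and (x, -1).\<close>

definition cover :: "'a set \<Rightarrow> ('a \<Rightarrow> 'a \<Rightarrow> complex) \<Rightarrow> ('a \<Rightarrow> 'a \<Rightarrow> complex) \<Rightarrow>
    (('a \<times> complex) \<times> ('a \<times> complex)) set" where
  "cover X L M = {((x, a), (y, b)) | x a y b. x \<in> X \<and> y \<in> X \<and> a \<in> {1, -1} \<and> b \<in> {1, -1} \<and>
    L x y \<noteq> 0 \<and> M x y = a * b * L x y}"

lemma cover_iff: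
  "((x, a), (y, b)) \<in> cover X L M \<longleftrightarrow> x \<in> X \<and> y \<in> X \<and> a \<in> {1, -1} \<and> b \<in> {1, -1} \<and>
    L x y \<noteq> 0 \<and> M x y = a * b * L x y"
  by (simp add: cover_def)

lemma relpow_segment:
  assumes "\<And>i. i < n \<Longrightarrow> (F i, F (Suc i)) \<in> R" and "i \<le> j" and "j \<le> n"
  shows "(F i, F j) \<in> R ^^ (j - i)"
  unfolding relpow_fun_conv using assms
  by (intro exI[of _ "\<lambda>k. F (i + k)"]) auto

section \<open>Equal minors and closed walks in the double cover\<close>

locale equal_minors =
  fixes X :: "'a set" and L M :: "'a \<Rightarrow> 'a \<Rightarrow> complex"
  assumes symL: "\<lbrakk>x \<in> X; y \<in> X\<rbrakk> \<Longrightarrow> L x y = L y x"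
    and symM: "\<lbrakk>x \<in> X; y \<in> X\<rbrakk> \<Longrightarrow> M x y = M y x"
    and minors: "(\<And>i. i < n \<Longrightarrow> v i \<in> X) \<Longrightarrow> bifun_det L n v = bifun_det M n v"
begin

lemma diagonal_eq: "x \<in> X \<Longrightarrow> M x x = L x x"
  using minors[of 1 "\<lambda>_. x"] by (simp add: bifun_det_def det_single)

text \<open>The diagonals agree, so the minors of size two leave an equality of squares off the
  diagonal.\<close>

lemma eq_or_minus:
  assumes "x \<in> X" "y \<in> X"
  shows "M x y = L x y \<or> M x y = - L x y"
proof -
  have "bifun_det L 2 (\<lambda>i. if i = 0 then x else y) = bifun_det M 2 (\<lambda>i. if i = 0 then x else y)"
    using assms by (intro minors) auto
  then have "(M x y)\<^sup>2 = (L x y)\<^sup>2"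
    using diagonal_eq assms symL[OF assms] symM[OF assms]
    by (simp add: bifun_det_2 power2_eq_square)
  then show ?thesis
    by (simp add: power2_eq_iff)
qed

abbreviation R where "R \<equiv> cover X L M"

lemma sym_R: "sym R"
  unfolding sym_def using symL symM by (auto simp: cover_iff)

text \<open>Since M / L is a sign on every edge, an edge lifts to the cover from either
  sheet.\<close>

lemma edge_sign:
  assumes "x \<in> X" "y \<in> X" "L x y \<noteq> 0" "a \<in> {1, -1}"
  obtains b where "b \<in> {1, -1}" "((x, a), (y, b)) \<in> R"
proof -
  have "((x, a), (y, a)) \<in> R \<or> ((x, a), (y, - a)) \<in> R"
    using eq_or_minus[OF assms(1,2)] assms by (auto simp: cover_iff)
  then show ?thesis
    using that[of a] that[of "- a"] assms(4) by auto
qed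

text \<open>Strong induction on the length plays the part of a shortest walk. The condition
  \<open>a \<noteq> 0\<close> excludes the empty walk from \<open>(x, 0)\<close> to itself.\<close>

lemma no_negative_closed_walk:
  assumes "a \<noteq> 0"
  shows "((x, a), (x, - a)) \<notin> R ^^ n"
  using assms
proof (induction n arbitrary: x a rule: less_induct)
  case (less n)
  show ?case
  proof
    assume "((x, a), (x, - a)) \<in> R ^^ n"
    then obtain F where F: "F 0 = (x, a)" "F n = (x, - a)" 
        "\<And>i. i < n \<Longrightarrow> (F i, F (Suc i)) \<in> R"
      unfolding relpow_fun_conv by blast
    define v where "v i = fst (F i)" for i
    define g where "g i = snd (F i)" for i
    have F_eq: "F i = (v i, g i)" for i
      by (simp add: v_def g_def)
    have ends: "v n = v 0" "g n = - g 0" "v 0 = x" "g 0 = a"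
      using F by (auto simp: v_def g_def)
    have R: "((v i, g i), (v (Suc i), g (Suc i))) \<in> R" if "i < n" for i
      using F(3)[OF that] by (simp add: F_eq)
    have "n \<noteq> 0"
      using F less.prems by (intro notI) auto
    have vX: "v i \<in> X" and g: "g i \<in> {1, -1}" if "i < n" for i
      using R[OF that] by (simp_all add: cover_iff)
    have step: "M (v i) (v (Suc i)) = g i * g (Suc i) * L (v i) (v (Suc i))"
        "L (v i) (v (Suc i)) \<noteq> 0" if "i < n" for i
      using R[OF that] by (simp_all add: cover_iff)
    \<comment> \<open>Length one would be a loop with M = -L, against the equal diagonals. Length
      two would cross one edge back and forth with opposite signs, against symmetry.\<close>
    have "n \<noteq> 1"
      using step[of 0] ends diagonal_eq[of "v 0"] vX[of 0] g[of 0] by auto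
    moreover have "n \<noteq> 2"
      using step[of 0] step[of 1] ends vX[of 0] vX[of 1] g[of 0] g[of 1]
        symL[of "v 0" "v 1"] symM[of "v 0" "v 1"]
      by (auto simp: numeral_2_eq_2)
    ultimately have n: "n \<ge> 3"
      using \<open>n \<noteq> 0\<close> by linarith
    have chordless: "L (v i) (v j) = 0" if ij: "Suc i < j" "j < n" "i \<noteq> 0 \<or> j \<noteq> n - 1" for i j
    proof (rule ccontr)
      assume "L (v i) (v j) \<noteq> 0"
      then obtain b where b: "b \<in> {1, -1}" "((v i, g i), (v j, b)) \<in> R"
        using edge_sign vX g ij by (metis Suc_lessD order.strict_trans)
      then consider "b = g j" | "b = - g j"
        using g[of j] ij by auto
      then show False
      proof cases
        case 1
        \<comment> \<open>The chord lifts to a shortcut past the vertices strictly between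
          \<open>i\<close> and \<open>j\<close>.\<close>
        have "(F 0, F j) \<in> R ^^ (i + 1)"
          using relpow_segment[of n F R 0 i] F(3) ij b(2) 1 by (auto simp: F_eq)
        moreover have "(F j, F n) \<in> R ^^ (n - j)"
          using relpow_segment[of n F R j n] F(3) ij by auto
        ultimately have "(F 0, F n) \<in> R ^^ (i + 1 + (n - j))"
          unfolding relpow_add by blast
        moreover have "i + 1 + (n - j) < n"
          using ij by linarith
        ultimately show False
          using less F(1,2) by metis
      next
        case 2
        \<comment> \<open>The chord, crossed backwards after the segment from \<open>i\<close> to
          \<open>j\<close>, closes that segment with sign -1. The result is shorter than
          \<open>n\<close> because the pair 0, \<open>n - 1\<close> is excluded.\<close>
        have "((v j, g j), (v i, - g i)) \<in> R"
          using b ij 2 g[of i] g[of j] symL[of "v i" "v j"] symM[of "v i" "v j"]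
          by (simp add: cover_iff) auto
        moreover have "(F i, F j) \<in> R ^^ (j - i)"
          using relpow_segment[of n F R i j] F(3) ij by auto
        ultimately have "((v i, g i), (v i, - g i)) \<in> R ^^ (Suc (j - i))"
          by (auto simp: F_eq)
        moreover have "g i \<noteq> 0"
          using g[of i] ij by auto
        moreover have "Suc (j - i) < n"
          using ij by linarith
        ultimately show False
          using less.IH \<open>g i \<noteq> 0\<close> by blast
      qed
    qed
    define m where "m = n - 1"
    have m: "n = Suc m" "m \<ge> 2"
      using n by (simp_all add: m_def)
    \<comment> \<open>Because \<open>g n = - g 0\<close>, the sign defect of the whole walk lands on
      the closing edge.\<close>
    have corner: "M (v m) (v 0) = - g m * g 0 * L (v m) (v 0)" "L (v m) (v 0) \<noteq> 0"
      using step[of m] ends m by simp_all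
    have "bifun_det L n v \<noteq> bifun_det M n v"
    proof (rule bifun_det_chordless_cycle_neq[where g = g])
      show "g i \<noteq> 0" if "i < n" for i
        using g[OF that] by auto
      show "L (v 0) (v (n - 1)) \<noteq> 0"
        using corner symL[of "v 0" "v m"] vX m by simp
      show "M (v i) (v j) = g i * (1 / g j) *
          ((if i = 0 \<and> j = n - 1 \<or> i = n - 1 \<and> j = 0 then -1 else 1) * L (v i) (v j))"
        if "i < n" "j < n" for i j
      proof -
        \<comment> \<open>Up to symmetry a pair is diagonal, the closing edge, a consecutive pair,
          or a chord, where both entries vanish.\<close>
        have *: "M (v i) (v j) = g i * g j *
            ((if i = 0 \<and> j = m \<or> i = m \<and> j = 0 then -1 else 1) * L (v i) (v j))"
          if ij: "i \<le> j" "j < n" for i j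
        proof -
          consider "i = j" | "i = 0" "j = m" | "j = Suc i" "i \<noteq> 0 \<or> j \<noteq> m"
            | "Suc i < j" "i \<noteq> 0 \<or> j \<noteq> m"
            using ij by linarith
          then show ?thesis
          proof cases
            case 1
            then show ?thesis
              using diagonal_eq[OF vX] g[of i] ij m by auto
          next
            case 2
            then show ?thesis
              using corner symL[of "v 0" "v m"] symM[of "v 0" "v m"] vX m by simp
          next
            case 3
            then show ?thesis
              using step[of i] ij m by auto
          next
            case 4
            then show ?thesis
              using chordless[of i j] eq_or_minus[of "v i" "v j"] vX ij m by auto
          qed
        qed
        have "M (v i) (v j) = g i * g j *
            ((if i = 0 \<and> j = m \<or> i = m \<and> j = 0 then -1 else 1) * L (v i) (v j))"
        proof (cases "i \<le> j")
          case True
          then show ?thesis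
            using * that by blast
        next
          case False
          then have "M (v j) (v i) = g j * g i *
              ((if j = 0 \<and> i = m \<or> j = m \<and> i = 0 then -1 else 1) * L (v j) (v i))"
            using * that by simp
          moreover have "L (v i) (v j) = L (v j) (v i)" "M (v i) (v j) = M (v j) (v i)"
            using symL symM vX that by blast+
          ultimately show ?thesis
            by (simp add: conj_commute disj_commute mult.commute)
        qed
        moreover have "g j = 1 / g j"
          using g[OF that(2)] by auto
        ultimately show ?thesis
          by (metis m_def)
      qed
    qed (use n chordless step(2) symL vX in auto)
    then show False
      using minors vX by blast
  qed
qed

section \<open>Construction of the sign function\<close>

text \<open>Reversing one walk and appending the other would give a closed walk of sign -1 if the
  sheets differed.\<close>

lemma cover_connected_sign_unique:
  assumes "(p, (x, a)) \<in> R\<^sup>*" "(p, (x, b)) \<in> R\<^sup>*" "a \<in> {1, -1}" "b \<in> {1, -1}"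
  shows "a = b"
proof (rule ccontr)
  assume "a \<noteq> b"
  then have "b = - a"
    using assms by auto
  moreover have "((x, a), (x, b)) \<in> R\<^sup>*"
    using assms(1,2) sym_rtrancl[OF sym_R] by (meson rtrancl_trans symD)
  ultimately show False
    using no_negative_closed_walk[of a x] rtrancl_imp_relpow assms(3) by fastforce
qed

lemma ex_sign_rescaling:
  "\<exists>f. (\<forall>x\<in>X. f x \<in> {1, -1}) \<and> (\<forall>x\<in>X. \<forall>y\<in>X. M x y = f x * f y * L x y)"
proof -
  \<comment> \<open>\<open>root x\<close> is a base point of the component of \<open>x\<close>, and
    \<open>f x\<close> is the sheet reached over \<open>x\<close> from sheet 1 over that base point.
    The point \<open>x\<close> itself is always a candidate, by the empty walk.\<close>
  define root where "root x = (SOME z. \<exists>a\<in>{1, -1}. ((z, 1), (x, a)) \<in> R\<^sup>*)" for x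
  define f where "f x = (SOME a. a \<in> {1, -1} \<and> ((root x, 1), (x, a)) \<in> R\<^sup>*)" for x
  have "\<exists>a\<in>{1, -1}. ((root x, 1), (x, a)) \<in> R\<^sup>*" for x
    unfolding root_def by (rule someI[of _ x]) auto
  then have f: "f x \<in> {1, -1}" "((root x, 1), (x, f x)) \<in> R\<^sup>*" for x
    unfolding f_def by (metis (mono_tags, lifting) someI_ex)+
  have reach: "\<exists>b\<in>{1, -1}. (p, (y, b)) \<in> R\<^sup>*"
    if "x \<in> X" "y \<in> X" "L x y \<noteq> 0" "a \<in> {1, -1}" "(p, (x, a)) \<in> R\<^sup>*" for p x y a
    using edge_sign[OF that(1-4)] that(5) by (metis rtrancl.rtrancl_into_rtrancl)
  have "M x y = f x * f y * L x y" if xy: "x \<in> X" "y \<in> X" for x y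
  proof (cases "L x y = 0")
    case True
    then show ?thesis
      using eq_or_minus[OF xy] by auto
  next
    case False
    then have False': "L y x \<noteq> 0"
      using symL[OF xy] by simp
    \<comment> \<open>Adjacent points have the same candidates for a base point, so the choice
      operator returns the same one for both.\<close>
    have "(\<exists>a\<in>{1, -1}. ((z, 1), (x, a)) \<in> R\<^sup>*) = (\<exists>a\<in>{1, -1}. ((z, 1), (y, a)) \<in> R\<^sup>*)" for z
      using reach[OF xy False] reach[OF xy(2,1) False'] by blast
    then have root: "root x = root y"
      by (simp add: root_def)
    obtain b where b: "b \<in> {1, -1}" "((x, f x), (y, b)) \<in> R"
      using edge_sign[OF xy False f(1)] .
    have "((root y, 1), (y, b)) \<in> R\<^sup>*"
      using f(2)[of x] b(2) root by (metis rtrancl.rtrancl_into_rtrancl)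
    then have "b = f y"
      using cover_connected_sign_unique f b(1) by blast
    then show ?thesis
      using b(2) by (simp add: cover_iff)
  qed
  then show ?thesis
    using f(1) by blast
qed

end

theorem theorem1p4:
  fixes X :: "'a set" and L M :: "'a \<Rightarrow> 'a \<Rightarrow> complex"
  assumes "symmetric_on X L" and "symmetric_on X M"
  shows "reciprocal_rescalings X L M \<longleftrightarrow>
    (\<forall>(n::nat) (x :: nat \<Rightarrow> 'a). (\<forall>i<n. x i \<in> X) \<longrightarrow> bifun_det L n x = bifun_det M n x)"
proof
  assume "reciprocal_rescalings X L M"
  then show "\<forall>n x. (\<forall>i<n. x i \<in> X) \<longrightarrow> bifun_det L n x = bifun_det M n x"
    using bifun_det_eq_if_reciprocal_rescalings by blast
next
  assume "\<forall>n x. (\<forall>i<n. x i \<in> X) \<longrightarrow> bifun_det L n x = bifun_det M n x"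
  then interpret equal_minors X L M
    using assms by unfold_locales (auto simp: symmetric_on_def)
  obtain f where f: "\<And>x. x \<in> X \<Longrightarrow> f x \<in> {1, -1}"
      "\<And>x y. \<lbrakk>x \<in> X; y \<in> X\<rbrakk> \<Longrightarrow> M x y = f x * f y * L x y"
    using ex_sign_rescaling by blast
  \<comment> \<open>A sign is its own inverse, which turns the product form into the reciprocal
    form.\<close>
  have "f x \<noteq> 0" "1 / f x = f x" if "x \<in> X" for x
    using f(1)[OF that] by auto
  then show "reciprocal_rescalings X L M"
    unfolding reciprocal_rescalings_def using f(2) by (intro exI[of _ f]) auto
qed

end
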